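(* In the payment network creation game with $n$ players, betweenness weight $b$ and closeness weight $c$ with $1<c<b$, the price of anarchy is $$\mathrm{PoA}=\frac{\left(\frac12+(n-2)\,b\right) n}{1+\left(\frac23 b+\frac13 c\right) n(n-2)}.$$
   Context: Payment network creation game. There are $n\ge 2$ players $[n]=\{0,1,\dots,n-1\}$. A strategy of player $u$ is a set $s_u\subseteq [n]\setminus\{u\}$ (the players to whom $u$ opens a channel). A strategy combination is $s=(s_0,\dots,s_{n-1})$, and $G[s]$ is the undirected simple graph on $[n]$ in which $u,v$ are adjacent iff $v\in s_u$ or $u\in s_v$. With weights $b\ge 0$ and $c>0$, the cost of $u$ is $$\mathrm{cost}_u(s)=|s_u|+b\cdot \mathrm{betweenness}_u(s)+c\cdot \mathrm{closeness}_u(s),$$ $$\mathrm{betweenness}_u(s)=(n-1)(n-2)-\sum_{\substack{(i,j)\in[n]^2:\ i\ne j,\ i\neq u,\ j\ne u,\\ m(i,j)>0}}\frac{m_u(i,j)}{m(i,j)},\qquad \mathrm{closeness}_u(s)=\sum_{v\in[n]\setminus\{u\}}\bigl(d_{G[s]}(u,v)-1\bigr).$$ The sum in the betweenness runs over ordered pairs; $m(i,j)$ is the number of shortest paths between $i$ and $j$ in $G[s]$ and $m_u(i,j)$ the number of those passing through $u$; $d_{G[s]}$ is graph distance, equal to $\infty$ between different components. The social cost is $\mathrm{cost}(s)=\sum_{u}\mathrm{cost}_u(s)$. A strategy combination is a Nash equilibrium if no player can strictly decrease her cost by unilaterally changing her strategy; equilibrium graphs are taken to be connected (a player's cost is infinite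 in a disconnected graph, and disconnected strategy combinations are not regarded as equilibria). With $S$ the set of all strategy combinations and $N$ the set of Nash equilibria, $\mathrm{PoA}=\dfrac{\max_{s\in N}\mathrm{cost}(s)}{\min_{s\in S}\mathrm{cost}(s)}$. *)

theory Defs
  imports
    "HOL-Library.FuncSet"
    "HOL-Library.Extended_Real"
    "Graph_Theory.Graph_Theory"
begin

definition players :: "nat \<Rightarrow> nat set" where
  "players n = {..<n}"

definition strategies :: "nat \<Rightarrow> nat \<Rightarrow> nat set set" where
  "strategies n u = Pow (players n - {u})"

(* Extensional function space: a strategy combination is an n-tuple, with no
   information outside the players, so this set is finite. *)
definition strategy_combinations :: "nat \<Rightarrow> (nat \<Rightarrow> nat set) set" where
  "strategy_combinations n = (\<Pi>\<^sub>E u\<in>players n. strategies n u)"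

(* An undirected simple graph is represented, as usual in Graph_Theory, by a symmetric
   loop-free digraph without parallel arcs (locale graph; see graph_channel_graph). *)
definition channel_graph :: "nat \<Rightarrow> (nat \<Rightarrow> nat set) \<Rightarrow> (nat, nat \<times> nat) pre_digraph" where
  "channel_graph n s = with_proj
     \<lparr> pverts = players n,
       parcs = {(u, v) \<in> players n \<times> players n. u \<noteq> v \<and> (v \<in> s u \<or> u \<in> s v)} \<rparr>"

lemma graph_channel_graph: "graph (channel_graph n s)"
proof -
  have "finite {(u, v) \<in> players n \<times> players n. u \<noteq> v \<and> (v \<in> s u \<or> u \<in> s v)}"
    by (rule finite_subset[of _ "players n \<times> players n"]) (auto simp: players_def)
  then show ?thesis
    by unfold_locales
       (auto simp: channel_graph_def players_def arc_to_ends_def symmetric_conv)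
qed

(* All arcs have weight 1; the distance is infinite between different components. *)
definition graph_dist :: "nat \<Rightarrow> (nat \<Rightarrow> nat set) \<Rightarrow> nat \<Rightarrow> nat \<Rightarrow> ereal" where
  "graph_dist n s u v = wf_digraph.\<mu> (channel_graph n s) (\<lambda>_. 1) u v"

definition shortest_paths ::
    "nat \<Rightarrow> (nat \<Rightarrow> nat set) \<Rightarrow> nat \<Rightarrow> nat \<Rightarrow> (nat \<times> nat) awalk set" where
  "shortest_paths n s i j =
     {p. pre_digraph.apath (channel_graph n s) i p j \<and> ereal (real (length p)) = graph_dist n s i j}"

definition num_shortest_paths :: "nat \<Rightarrow> (nat \<Rightarrow> nat set) \<Rightarrow> nat \<Rightarrow> nat \<Rightarrow> nat" where
  "num_shortest_paths n s i j = card (shortest_paths n s i j)"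

definition num_shortest_paths_through ::
    "nat \<Rightarrow> (nat \<Rightarrow> nat set) \<Rightarrow> nat \<Rightarrow> nat \<Rightarrow> nat \<Rightarrow> nat" where
  "num_shortest_paths_through n s u i j =
     card {p \<in> shortest_paths n s i j. u \<in> set (pre_digraph.awalk_verts (channel_graph n s) i p)}"

definition betweenness :: "nat \<Rightarrow> (nat \<Rightarrow> nat set) \<Rightarrow> nat \<Rightarrow> real" where
  "betweenness n s u =
     (real n - 1) * (real n - 2) -
     (\<Sum>(i, j) \<in> {(i, j) \<in> players n \<times> players n.
                   i \<noteq> j \<and> i \<noteq> u \<and> j \<noteq> u \<and> num_shortest_paths n s i j > 0}.
        real (num_shortest_paths_through n s u i j) / real (num_shortest_paths n s i j))"

definition closeness :: "nat \<Rightarrow> (nat \<Rightarrow> nat set) \<Rightarrow> nat \<Rightarrow> ereal" where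
  "closeness n s u = (\<Sum>v \<in> players n - {u}. graph_dist n s u v - 1)"

definition player_cost ::
    "nat \<Rightarrow> real \<Rightarrow> real \<Rightarrow> (nat \<Rightarrow> nat set) \<Rightarrow> nat \<Rightarrow> ereal" where
  "player_cost n b c s u =
     ereal (real (card (s u)) + b * betweenness n s u) + ereal c * closeness n s u"

definition social_cost :: "nat \<Rightarrow> real \<Rightarrow> real \<Rightarrow> (nat \<Rightarrow> nat set) \<Rightarrow> ereal" where
  "social_cost n b c s = (\<Sum>u \<in> players n. player_cost n b c s u)"

(* connected is qualified because topological connectedness has the same base name. *)
definition nash_equilibria :: "nat \<Rightarrow> real \<Rightarrow> real \<Rightarrow> (nat \<Rightarrow> nat set) set" where
  "nash_equilibria n b c =
     {s \<in> strategy_combinations n.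
        Digraph_Component.connected (channel_graph n s) \<and>
        \<not> (\<exists>u \<in> players n. \<exists>t \<in> strategies n u.
             player_cost n b c (s(u := t)) u < player_cost n b c s u)}"

definition price_of_anarchy :: "nat \<Rightarrow> real \<Rightarrow> real \<Rightarrow> ereal" where
  "price_of_anarchy n b c =
     Max (social_cost n b c ` nash_equilibria n b c) /
     Min (social_cost n b c ` strategy_combinations n)"

end

(*
  The excess sum over ordered pairs of (distance - 1) equals the total of all m_u(i,j)/m(i,j),
  because a shortest path of length d has d - 1 inner vertices.  Hence the social cost of a
  connected strategy combination is the number of purchases plus b n(n-1)(n-2) minus (b - c)
  times the excess, and since c < b it is minimised by a tree of maximal excess: the path.  The
  upper bound on the excess comes from building the vertex set by adding one neighbour at a time:
  the k-th vertex reached from v is at distance at most k from v.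
  In an equilibrium every missing channel would be bought, as it saves at least c > 1 in closeness
  and does not raise the betweenness cost, and no channel is paid for twice.  Conversely every
  complete graph with each channel bought once is an equilibrium, and all of them cost the same.
*)
theory Submission
  imports Defs
begin

section \<open>Distances in connected sets\<close>

text \<open>Connectivity in cut form, without mention of walks: a vertex set grown from one vertex
  can always be extended by a neighbour until it is all of \<open>A\<close>.\<close>

definition cut_connected :: "('a \<Rightarrow> 'a \<Rightarrow> bool) \<Rightarrow> 'a set \<Rightarrow> bool" where
  "cut_connected E A \<longleftrightarrow> (\<forall>B. B \<subset> A \<and> B \<noteq> {} \<longrightarrow> (\<exists>x\<in>B. \<exists>y\<in>A - B. E x y))"

lemma cut_connected_singleton: "cut_connected E {v}"
  by (auto simp: cut_connected_def)

text \<open>The edge between \<open>x\<close> and \<open>y\<close> crosses the cut that separates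
  \<open>y\<close> from \<open>B\<close>, in either direction by symmetry. Every other cut restricts
  to a proper nonempty subset of \<open>B\<close>.\<close>

lemma cut_connected_insert:
  assumes "cut_connected E B" "symp E" "x \<in> B" "y \<notin> B" "E x y"
  shows "cut_connected E (insert y B)"
  unfolding cut_connected_def
proof (intro allI impI, elim conjE)
  fix C assume C: "C \<subset> insert y B" "C \<noteq> {}"
  have cut: "\<exists>u\<in>D. \<exists>w\<in>B - D. E u w" if "D \<subset> B" "D \<noteq> {}" for D
    using assms(1) that by (simp add: cut_connected_def)
  consider "C = B" | "C \<subset> B" | "C = {y}" | "y \<in> C" "C - {y} \<subset> B" "C - {y} \<noteq> {}"
    using C by blast
  then show "\<exists>u\<in>C. \<exists>w\<in>insert y B - C. E u w"
  proof cases
    case 1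
    then show ?thesis using assms(3-5) by blast
  next
    case 2
    then show ?thesis using cut[of C] C by blast
  next
    case 3
    moreover have "E y x" using assms(2,5) by (rule sympD)
    ultimately show ?thesis using assms(3,4) by auto
  next
    case 4
    then show ?thesis using cut[of "C - {y}"] assms(4) by blast
  qed
qed

text \<open>A set of maximal size among those reached with \<open>P\<close> must be
  \<open>A\<close>: otherwise an edge leaves it and the step produces a larger one.\<close>

lemma cut_connected_induct [consumes 3, case_names singleton insert]:
  assumes "finite A" "cut_connected E A" "v \<in> A"
    and "P {v}"
    and step: "\<And>B x y. P B \<Longrightarrow> v \<in> B \<Longrightarrow> B \<subseteq> A \<Longrightarrow> x \<in> B \<Longrightarrow> y \<in> A - B \<Longrightarrow> E x y \<Longrightarrow> P (insert y B)"
  shows "P A"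
proof -
  have "\<exists>B. (v \<in> B \<and> B \<subseteq> A \<and> P B) \<and> (\<forall>C. v \<in> C \<and> C \<subseteq> A \<and> P C \<longrightarrow> card C \<le> card B)"
  proof (rule ex_has_greatest_nat[where b = "Suc (card A)"])
    show "v \<in> {v} \<and> {v} \<subseteq> A \<and> P {v}" using assms(3,4) by simp
  qed (use assms(1) in \<open>simp add: card_mono less_Suc_eq_le\<close>)
  then obtain B where B: "v \<in> B" "B \<subseteq> A" "P B"
    and max: "\<And>C. v \<in> C \<Longrightarrow> C \<subseteq> A \<Longrightarrow> P C \<Longrightarrow> card C \<le> card B"
    by (elim exE conjE) (rule that, assumption+, simp)
  have "B = A"
  proof (rule ccontr)
    assume "B \<noteq> A"
    then obtain x y where xy: "x \<in> B" "y \<in> A - B" "E x y"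
      using B assms(2) unfolding cut_connected_def by blast
    then have "card (insert y B) \<le> card B" using B step by (intro max) auto
    then show False using xy B assms(1) finite_subset by fastforce
  qed
  then show ?thesis using B by simp
qed

text \<open>In order of attachment the values are at most 0, 1, 2, and so on, whence the triangular
  number.\<close>

lemma sum_le_of_cut_connected:
  fixes f :: "'a \<Rightarrow> real"
  assumes "finite A" "cut_connected E A" "v \<in> A" "f v = 0"
    and step: "\<And>x y. x \<in> A \<Longrightarrow> y \<in> A \<Longrightarrow> E x y \<Longrightarrow> f y \<le> f x + 1"
  shows "(\<Sum>x\<in>A. f x) \<le> real (card A) * (real (card A) - 1) / 2"
proof -
  \<comment> \<open>The pointwise bound is carried along because a new value is controlled only
    through the value at its neighbour.\<close>
  have "(\<forall>x\<in>A. f x \<le> real (card A) - 1) \<and> (\<Sum>x\<in>A. f x) \<le> real (card A) * (real (card A) - 1) / 2"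
    using assms(1-3)
  proof (induction rule: cut_connected_induct)
    case singleton
    show ?case using assms(4) by simp
  next
    case (insert B x y)
    have fin: "finite B" using insert assms(1) finite_subset by blast
    have "f y \<le> f x + 1" using insert by (intro step) auto
    also have "f x \<le> real (card B) - 1" using insert by auto
    finally have fy: "f y \<le> real (card B)" by simp
    have *: "card (insert y B) = Suc (card B)" using insert fin by simp
    have "(\<Sum>x\<in>insert y B. f x) = f y + (\<Sum>x\<in>B. f x)" using insert fin by simp
    also have "\<dots> \<le> real (card B) + real (card B) * (real (card B) - 1) / 2"
      using insert fy by linarith
    finally show ?case unfolding * using insert fy by (auto simp: field_simps)
  qed
  then show ?thesis by blast
qed

text \<open>Attaching a vertex to \<open>m\<close> others adds one row and one column, each at most
  m(m+1)/2 by the previous lemma. Summing m(m+1) gives the cubic, which is the value for a path. The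
  function \<open>d\<close> stays that of the whole set and is not recomputed on the
  subsets.\<close>

lemma sum_dist_le_of_cut_connected:
  fixes d :: "'a \<Rightarrow> 'a \<Rightarrow> real"
  assumes "finite A" "cut_connected E A" "A \<noteq> {}" "symp E"
    and refl: "\<And>x. x \<in> A \<Longrightarrow> d x x = 0"
    and step: "\<And>x y z. x \<in> A \<Longrightarrow> y \<in> A \<Longrightarrow> z \<in> A \<Longrightarrow> E y z \<Longrightarrow> d x z \<le> d x y + 1 \<and> d z x \<le> d y x + 1"
  shows "(\<Sum>x\<in>A. \<Sum>y\<in>A. d x y) \<le> (real (card A) - 1) * real (card A) * (real (card A) + 1) / 3"
proof -
  obtain v where v: "v \<in> A" using assms(3) by blast
  \<comment> \<open>Cut-connectedness is part of the induction claim, so that the row and column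
    bounds apply to each intermediate set.\<close>
  have "cut_connected E A \<and>
    (\<Sum>x\<in>A. \<Sum>y\<in>A. d x y) \<le> (real (card A) - 1) * real (card A) * (real (card A) + 1) / 3"
    using assms(1,2) v
  proof (induction rule: cut_connected_induct)
    case singleton
    show ?case using refl v by (simp add: cut_connected_singleton)
  next
    case (insert B x y)
    let ?B = "insert y B" and ?m = "real (card B)"
    have fin: "finite B" using insert assms(1) finite_subset by blast
    have y: "y \<notin> B" "?B \<subseteq> A" and yA: "y \<in> A" using insert by auto
    have card: "real (card ?B) = ?m + 1" using y fin by simp
    have conn: "cut_connected E ?B" using insert assms(4) by (blast intro: cut_connected_insert)
    have row: "(\<Sum>z\<in>?B. d y z) \<le> real (card ?B) * (real (card ?B) - 1) / 2"
    proof (rule sum_le_of_cut_connected[OF _ conn])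
      fix a b assume "a \<in> ?B" "b \<in> ?B" "E a b"
      then show "d y b \<le> d y a + 1" using y(2) yA step[of y a b] by blast
    qed (use fin yA refl in auto)
    have col: "(\<Sum>z\<in>?B. d z y) \<le> real (card ?B) * (real (card ?B) - 1) / 2"
    proof (rule sum_le_of_cut_connected[OF _ conn])
      fix a b assume "a \<in> ?B" "b \<in> ?B" "E a b"
      then show "d b y \<le> d a y + 1" using y(2) yA step[of y a b] by blast
    qed (use fin yA refl in auto)
    have "(\<Sum>x\<in>?B. \<Sum>z\<in>?B. d x z) = (\<Sum>x\<in>B. \<Sum>z\<in>B. d x z) + (\<Sum>z\<in>?B. d y z) + (\<Sum>z\<in>?B. d z y)"
      using fin y(1) refl[OF yA] by (simp add: sum.distrib)
    also have "\<dots> \<le> (?m - 1) * ?m * (?m + 1) / 3 + (?m + 1) * ?m / 2 + (?m + 1) * ?m / 2"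
      using insert.IH row col unfolding card by (intro add_mono) auto
    also have "\<dots> = (real (card ?B) - 1) * real (card ?B) * (real (card ?B) + 1) / 3"
      unfolding card by (simp add: field_simps)
    finally show ?case using conn by blast
  qed
  then show ?thesis by blast
qed

text \<open>A connected graph has at least one edge fewer than vertices: the edge that attaches
  \<open>y\<close> is paid for by \<open>x\<close> or by \<open>y\<close>, and was not counted
  before. Counting purchases only inside the current set makes this increase visible.\<close>

lemma sum_card_ge_of_cut_connected:
  fixes s :: "'a \<Rightarrow> 'a set"
  assumes "finite A" "cut_connected (\<lambda>x y. y \<in> s x \<or> x \<in> s y) A" "A \<noteq> {}"
  shows "card A \<le> Suc (\<Sum>x\<in>A. card (s x \<inter> A))"
proof -
  obtain v where v: "v \<in> A" using assms(3) by blast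
  show ?thesis
    using assms(1,2) v
  proof (induction rule: cut_connected_induct)
    case singleton
    show ?case by simp
  next
    case (insert B x y)
    let ?B = "insert y B"
    have fin: "finite B" using insert assms(1) finite_subset by blast
    have y: "y \<notin> B" using insert by auto
    have mono: "card (s z \<inter> B) \<le> card (s z \<inter> ?B)" for z
      using fin by (intro card_mono) auto
    have "Suc (\<Sum>z\<in>B. card (s z \<inter> B)) \<le> (\<Sum>z\<in>?B. card (s z \<inter> ?B))"
    proof (cases "y \<in> s x")
      case True
      have "card (s x \<inter> B) < card (s x \<inter> ?B)"
        using True fin y by (intro psubset_card_mono) auto
      then have "(\<Sum>z\<in>B. card (s z \<inter> B)) < (\<Sum>z\<in>B. card (s z \<inter> ?B))"
        using fin insert mono by (intro sum_strict_mono_ex1) auto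
      then show ?thesis using fin y by simp
    next
      case False
      then have "x \<in> s y \<inter> ?B" using insert by auto
      then have "0 < card (s y \<inter> ?B)" using fin card_gt_0_iff by blast
      moreover have "(\<Sum>z\<in>B. card (s z \<inter> B)) \<le> (\<Sum>z\<in>B. card (s z \<inter> ?B))"
        using mono by (rule sum_mono)
      ultimately show ?thesis using fin y by simp
    qed
    then show ?case using insert fin by simp
  qed
qed

section \<open>Walks and distances in channel graphs\<close>

definition adjacent :: "nat \<Rightarrow> (nat \<Rightarrow> nat set) \<Rightarrow> nat \<Rightarrow> nat \<Rightarrow> bool" where
  "adjacent n s u v \<longleftrightarrow> u < n \<and> v < n \<and> u \<noteq> v \<and> (v \<in> s u \<or> u \<in> s v)"

lemma adjacent_sym: "adjacent n s u v \<longleftrightarrow> adjacent n s v u"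
  by (auto simp: adjacent_def)

lemma channel_graph_simps [simp]:
  "verts (channel_graph n s) = {..<n}"
  "arcs (channel_graph n s) = {(u, v). adjacent n s u v}"
  by (auto simp: channel_graph_def players_def adjacent_def)

lemma channel_graph_cong:
  "(\<And>u v. adjacent n s u v \<longleftrightarrow> adjacent n t u v) \<Longrightarrow> channel_graph n s = channel_graph n t"
  unfolding channel_graph_def players_def adjacent_def
  by (intro arg_cong[where f = with_proj]) auto

lemma awalk_verts_channel_graph [simp]:
  "pre_digraph.awalk_verts (channel_graph n s) = pawalk_verts"
  by (simp add: channel_graph_def awalk_verts_with_proj_eq)

lemma awalk_channel_graph_iff:
  "pre_digraph.awalk (channel_graph n s) u p v \<longleftrightarrow>
     u < n \<and> (\<forall>(x, y)\<in>set p. adjacent n s x y) \<and> pcas u p v"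
  using channel_graph_simps[of n s]
  by (auto simp: pre_digraph.awalk_def) (simp_all add: channel_graph_def cas_with_proj_eq)

lemma apath_channel_graph_iff:
  "pre_digraph.apath (channel_graph n s) u p v \<longleftrightarrow>
     pre_digraph.awalk (channel_graph n s) u p v \<and> distinct (pawalk_verts u p)"
  by (simp add: pre_digraph.apath_def)

lemma length_pawalk_verts [simp]: "length (pawalk_verts u p) = Suc (length p)"
  by (induction p arbitrary: u) auto

lemma pcas_ends_in_pawalk_verts:
  "pcas u p v \<Longrightarrow> u \<in> set (pawalk_verts u p) \<and> v \<in> set (pawalk_verts u p)"
  by (induction u p v rule: pcas.induct) auto

lemma pawalk_verts_less:
  assumes "pre_digraph.awalk (channel_graph n s) u p v" "x \<in> set (pawalk_verts u p)"
  shows "x < n"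
  using assms unfolding awalk_channel_graph_iff
  by (induction p arbitrary: u) (auto simp: adjacent_def)

lemma pcas_leaves_set:
  "pcas u p v \<Longrightarrow> u \<in> B \<Longrightarrow> v \<notin> B \<Longrightarrow> \<exists>(x, y)\<in>set p. x \<in> B \<and> y \<notin> B"
  by (induction p arbitrary: u) (auto, metis)

lemma awalk_adjacent: "adjacent n s u v \<Longrightarrow> pre_digraph.awalk (channel_graph n s) u [(u, v)] v"
  by (auto simp: awalk_channel_graph_iff adjacent_def)

lemma fin_digraph_channel_graph: "fin_digraph (channel_graph n s)"
  using graph_channel_graph digraph.axioms(1) graph.axioms(1) by blast

lemma wf_digraph_channel_graph: "wf_digraph (channel_graph n s)"
  using fin_digraph_channel_graph fin_digraph.axioms(1) by blast

lemma awalk_append: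
  "pre_digraph.awalk (channel_graph n s) u p v \<Longrightarrow> pre_digraph.awalk (channel_graph n s) v q w \<Longrightarrow>
   pre_digraph.awalk (channel_graph n s) u (p @ q) w"
  by (rule wf_digraph.awalk_appendI[OF wf_digraph_channel_graph])

text \<open>Connectedness is strong connectedness of the symmetrised graph, which here coincides
  with reachability since the arcs are symmetric already. The empty graph does not count as
  connected, hence \<open>n > 0\<close>.\<close>

lemma connected_channel_graph_iff:
  "Digraph_Component.connected (channel_graph n s) \<longleftrightarrow>
     n > 0 \<and> (\<forall>u<n. \<forall>v<n. \<exists>p. pre_digraph.awalk (channel_graph n s) u p v)"
proof -
  interpret graph "channel_graph n s" by (rule graph_channel_graph)
  show ?thesis
    unfolding connected_def strongly_connected_def reachable_mk_symmetric_eq[OF sym_arcs] reachable_awalk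
    by auto
qed

lemma awalk_cost_one: "wf_digraph.awalk_cost (\<lambda>_. 1) (p :: (nat \<times> nat) list) = real (length p)"
  by (simp add: wf_digraph.awalk_cost_def[OF wf_digraph_channel_graph] sum_list_triv)

lemma graph_dist_le_length:
  assumes "pre_digraph.awalk (channel_graph n s) u p v"
  shows "graph_dist n s u v \<le> ereal (real (length p))"
  using wf_digraph.min_cost_le_walk_cost[OF wf_digraph_channel_graph assms, of "\<lambda>_. 1"]
  by (simp add: graph_dist_def awalk_cost_one)

text \<open>If no walk exists the premise is vacuous, so that \<open>x\<close> may be infinite; this
  is how infinite distances are obtained.\<close>

lemma le_graph_distI:
  assumes "\<And>p. pre_digraph.awalk (channel_graph n s) u p v \<Longrightarrow> x \<le> ereal (real (length p))"
  shows "x \<le> graph_dist n s u v"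
  unfolding graph_dist_def wf_digraph.\<mu>_def[OF wf_digraph_channel_graph] awalk_cost_one
  using assms by (auto intro: INF_greatest)

lemma shortest_path_exists:
  assumes "Digraph_Component.connected (channel_graph n s)" "u < n" "v < n"
  obtains p where "p \<in> shortest_paths n s u v"
proof -
  interpret fin_digraph "channel_graph n s" by (rule fin_digraph_channel_graph)
  have "reachable (channel_graph n s) u v"
    using assms by (auto simp: connected_channel_graph_iff reachable_awalk)
  from min_cost_awalk[OF this, of "\<lambda>_. 1"] show ?thesis
    using that by (auto simp: shortest_paths_def graph_dist_def awalk_cost_one)
qed

section \<open>Real-valued distances in connected channel graphs\<close>

abbreviation connected_channels :: "nat \<Rightarrow> (nat \<Rightarrow> nat set) \<Rightarrow> bool" where
  "connected_channels n s \<equiv> Digraph_Component.connected (channel_graph n s)"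

text \<open>Since \<open>real_of_ereal\<close> sends infinity to 0, this is the distance only where
  \<open>graph_dist\<close> is finite, as it is everywhere in a connected graph.\<close>

definition hop_dist :: "nat \<Rightarrow> (nat \<Rightarrow> nat set) \<Rightarrow> nat \<Rightarrow> nat \<Rightarrow> real" where
  "hop_dist n s u v = real_of_ereal (graph_dist n s u v)"

lemma graph_dist_ge_1:
  assumes "u \<noteq> v"
  shows "1 \<le> graph_dist n s u v"
proof (rule le_graph_distI)
  fix p assume "pre_digraph.awalk (channel_graph n s) u p v"
  with assms have "p \<noteq> []" by (auto simp: awalk_channel_graph_iff)
  then show "1 \<le> ereal (real (length p))" by (cases p) auto
qed

lemma graph_dist_ge_2:
  assumes "u \<noteq> v" "\<not> adjacent n s u v"
  shows "2 \<le> graph_dist n s u v"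
proof (rule le_graph_distI)
  fix p assume p: "pre_digraph.awalk (channel_graph n s) u p v"
  then have "2 \<le> length p" using assms
    by (cases p; cases "tl p") (auto simp: awalk_channel_graph_iff)
  then show "2 \<le> ereal (real (length p))" by simp
qed

lemma graph_dist_adjacent:
  assumes "adjacent n s u v"
  shows "graph_dist n s u v = 1"
proof (rule antisym)
  show "graph_dist n s u v \<le> 1"
    using graph_dist_le_length[OF awalk_adjacent[OF assms]] by (simp add: one_ereal_def)
  show "1 \<le> graph_dist n s u v"
    using assms by (intro graph_dist_ge_1) (auto simp: adjacent_def)
qed

lemma graph_dist_eq_hop_dist:
  assumes "connected_channels n s" "u < n" "v < n"
  shows "graph_dist n s u v = ereal (hop_dist n s u v)"
proof -
  obtain p where "p \<in> shortest_paths n s u v" using shortest_path_exists[OF assms] .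
  then have "ereal (real (length p)) = graph_dist n s u v" by (simp add: shortest_paths_def)
  then show ?thesis unfolding hop_dist_def by (metis real_of_ereal.simps(1))
qed

lemma hop_dist_adjacent: "adjacent n s u v \<Longrightarrow> hop_dist n s u v = 1"
  by (simp add: hop_dist_def graph_dist_adjacent)

lemma hop_dist_ge_1:
  "connected_channels n s \<Longrightarrow> u < n \<Longrightarrow> v < n \<Longrightarrow> u \<noteq> v \<Longrightarrow> 1 \<le> hop_dist n s u v"
  using graph_dist_ge_1[of u v n s] by (simp add: graph_dist_eq_hop_dist)

lemma shortest_path_length:
  "p \<in> shortest_paths n s u v \<Longrightarrow> real (length p) = hop_dist n s u v"
  unfolding shortest_paths_def hop_dist_def by (metis (mono_tags, lifting) mem_Collect_eq real_of_ereal.simps(1))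

lemma hop_dist_le_length:
  assumes "connected_channels n s" "v < n" "pre_digraph.awalk (channel_graph n s) u p v"
  shows "hop_dist n s u v \<le> real (length p)"
proof -
  have "u < n" using assms(3) by (simp add: awalk_channel_graph_iff)
  then show ?thesis
    using graph_dist_le_length[OF assms(3)] assms(1,2) by (simp add: graph_dist_eq_hop_dist)
qed

lemma shortest_path_awalk:
  "p \<in> shortest_paths n s u v \<Longrightarrow> pre_digraph.awalk (channel_graph n s) u p v"
  by (simp add: shortest_paths_def apath_channel_graph_iff)

lemma hop_dist_self:
  assumes "connected_channels n s" "u < n"
  shows "hop_dist n s u u = 0"
proof -
  have "hop_dist n s u u \<le> real (length ([] :: (nat \<times> nat) list))"
    using assms by (intro hop_dist_le_length) (auto simp: awalk_channel_graph_iff)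
  moreover obtain p where "p \<in> shortest_paths n s u u"
    using shortest_path_exists[OF assms assms(2)] .
  then have "hop_dist n s u u \<ge> 0" using shortest_path_length by (metis of_nat_0_le_iff)
  ultimately show ?thesis by simp
qed

lemma hop_dist_step:
  assumes "connected_channels n s" "x < n" "adjacent n s y z"
  shows "hop_dist n s x z \<le> hop_dist n s x y + 1" "hop_dist n s z x \<le> hop_dist n s y x + 1"
proof -
  have yz: "y < n" "z < n" using assms(3) by (auto simp: adjacent_def)
  obtain p where p: "p \<in> shortest_paths n s x y"
    using shortest_path_exists[OF assms(1,2) yz(1)] .
  have "hop_dist n s x z \<le> real (length (p @ [(y, z)]))"
    using assms yz p by (intro hop_dist_le_length awalk_append[OF shortest_path_awalk awalk_adjacent])
  then show "hop_dist n s x z \<le> hop_dist n s x y + 1"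
    using shortest_path_length[OF p] by simp
  obtain q where q: "q \<in> shortest_paths n s y x"
    using shortest_path_exists[OF assms(1) yz(1) assms(2)] .
  have "hop_dist n s z x \<le> real (length ([(z, y)] @ q))"
    using assms yz q
    by (intro hop_dist_le_length awalk_append[OF awalk_adjacent shortest_path_awalk])
       (simp_all add: adjacent_sym)
  then show "hop_dist n s z x \<le> hop_dist n s y x + 1"
    using shortest_path_length[OF q] by simp
qed

lemma finite_shortest_paths: "finite (shortest_paths n s u v)"
proof -
  interpret fin_digraph "channel_graph n s" by (rule fin_digraph_channel_graph)
  show ?thesis unfolding shortest_paths_def by (rule finite_subset[OF _ apaths_finite]) auto
qed

lemma num_shortest_paths_pos:
  assumes "connected_channels n s" "u < n" "v < n"
  shows "0 < num_shortest_paths n s u v"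
  using shortest_path_exists[OF assms] finite_shortest_paths[of n s u v]
  by (auto simp: num_shortest_paths_def card_gt_0_iff)

text \<open>The passage from walks to cuts: a walk from a vertex in \<open>B\<close> to one outside
  must use an arc that leaves \<open>B\<close>.\<close>

lemma cut_connected_channels:
  assumes "connected_channels n s"
  shows "cut_connected (adjacent n s) {..<n}"
  unfolding cut_connected_def
proof (intro allI impI, elim conjE)
  fix B assume "B \<subset> {..<n}" "B \<noteq> {}"
  then obtain x y where "x \<in> B" "y \<notin> B" "x < n" "y < n" by blast
  moreover from this obtain p where p: "pre_digraph.awalk (channel_graph n s) x p y"
    using assms by (auto simp: connected_channel_graph_iff)
  ultimately obtain u v where "(u, v) \<in> set p" "u \<in> B" "v \<notin> B"
    using pcas_leaves_set[of x p y B] by (auto simp: awalk_channel_graph_iff)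
  moreover from this p have "adjacent n s u v" by (auto simp: awalk_channel_graph_iff)
  ultimately show "\<exists>x\<in>B. \<exists>y\<in>{..<n} - B. adjacent n s x y"
    by (auto simp: adjacent_def)
qed

section \<open>Total excess, betweenness and the social cost\<close>

definition total_excess :: "nat \<Rightarrow> (nat \<Rightarrow> nat set) \<Rightarrow> real" where
  "total_excess n s = (\<Sum>u<n. \<Sum>v\<in>{..<n} - {u}. hop_dist n s u v - 1)"

lemma total_excess_eq:
  assumes "connected_channels n s"
  shows "total_excess n s = (\<Sum>u<n. \<Sum>v<n. hop_dist n s u v) - real n * (real n - 1)"
proof -
  have "(\<Sum>v\<in>{..<n} - {u}. hop_dist n s u v - 1) = (\<Sum>v<n. hop_dist n s u v) - (real n - 1)"
    if "u < n" for u
    using that assms by (simp add: sum_subtractf sum_diff1 hop_dist_self of_nat_diff)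
  then show ?thesis by (simp add: total_excess_def sum_subtractf)
qed

lemma total_excess_le:
  assumes "connected_channels n s"
  shows "total_excess n s \<le> real n * (real n - 1) * (real n - 2) / 3"
proof -
  have "(\<Sum>u<n. \<Sum>v<n. hop_dist n s u v) \<le> (real n - 1) * real n * (real n + 1) / 3"
    using sum_dist_le_of_cut_connected[OF _ cut_connected_channels[OF assms], of "hop_dist n s"]
      hop_dist_self[OF assms] hop_dist_step[OF assms] assms
    by (auto simp: connected_channel_graph_iff symp_def adjacent_sym)
  then show ?thesis using total_excess_eq[OF assms] by (simp add: field_simps)
qed

lemma sum_card_strategies_ge:
  assumes "connected_channels n s" "\<And>u. u < n \<Longrightarrow> s u \<subseteq> {..<n}"
  shows "real n - 1 \<le> (\<Sum>u<n. real (card (s u)))"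
proof -
  have "cut_connected (\<lambda>x y. y \<in> s x \<or> x \<in> s y) {..<n}"
    using cut_connected_channels[OF assms(1)] unfolding cut_connected_def adjacent_def by meson
  moreover have "n > 0" using assms(1) by (simp add: connected_channel_graph_iff)
  ultimately have "n \<le> Suc (\<Sum>x<n. card (s x \<inter> {..<n}))"
    using sum_card_ge_of_cut_connected[of "{..<n}" s] by (simp add: lessThan_empty_iff)
  also have "(\<Sum>x<n. card (s x \<inter> {..<n})) = (\<Sum>x<n. card (s x))"
    using assms(2) by (intro sum.cong refl arg_cong[where f = card]) auto
  finally have "real n \<le> real (Suc (\<Sum>x<n. card (s x)))" by (rule of_nat_mono)
  then show ?thesis by simp
qed

text \<open>Double counting of pairs of a shortest path and an inner vertex on it. All shortest
  paths have the same length \<open>L\<close>, and being simple each has \<open>L + 1\<close>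
  vertices, two of which are the ends.\<close>

lemma sum_through_fraction:
  assumes "connected_channels n s" "i < n" "j < n" "i \<noteq> j"
  shows "(\<Sum>u\<in>{u\<in>{..<n}. i \<noteq> u \<and> j \<noteq> u}.
      real (num_shortest_paths_through n s u i j) / real (num_shortest_paths n s i j)) =
    hop_dist n s i j - 1"
proof -
  obtain L where L: "\<And>p. p \<in> shortest_paths n s i j \<Longrightarrow> length p = L" "real L = hop_dist n s i j"
    using shortest_path_exists[OF assms(1-3)] shortest_path_length by (metis of_nat_eq_iff)
  have "L \<ge> 1" using hop_dist_ge_1[OF assms] L(2) by simp
  have inner: "card {u\<in>{u\<in>{..<n}. i \<noteq> u \<and> j \<noteq> u}. u \<in> set (pawalk_verts i p)} = L - 1"
    if p: "p \<in> shortest_paths n s i j" for p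
  proof -
    let ?V = "set (pawalk_verts i p)"
    have walk: "pre_digraph.awalk (channel_graph n s) i p j" by (rule shortest_path_awalk[OF p])
    have "{u\<in>{u\<in>{..<n}. i \<noteq> u \<and> j \<noteq> u}. u \<in> ?V} = ?V - {i, j}"
      using pawalk_verts_less[OF walk] by auto
    moreover have "{i, j} \<subseteq> ?V"
      using walk pcas_ends_in_pawalk_verts[of i p j] by (simp add: awalk_channel_graph_iff)
    moreover have "distinct (pawalk_verts i p)"
      using p by (simp add: shortest_paths_def apath_channel_graph_iff)
    then have "card ?V = Suc L" using L(1)[OF p] by (simp add: distinct_card)
    ultimately show ?thesis using assms(4) by (simp add: card_Diff_subset)
  qed
  have "(\<Sum>u\<in>{u\<in>{..<n}. i \<noteq> u \<and> j \<noteq> u}. num_shortest_paths_through n s u i j) =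
      (L - 1) * num_shortest_paths n s i j"
    unfolding num_shortest_paths_through_def num_shortest_paths_def awalk_verts_channel_graph
    by (rule sum_multicount) (use inner finite_shortest_paths in auto)
  then have "(\<Sum>u\<in>{u\<in>{..<n}. i \<noteq> u \<and> j \<noteq> u}. real (num_shortest_paths_through n s u i j)) =
      (real L - 1) * real (num_shortest_paths n s i j)"
    using \<open>L \<ge> 1\<close> by (simp flip: of_nat_sum add: of_nat_diff)
  then show ?thesis
    using num_shortest_paths_pos[OF assms(1-3)] L(2) by (simp flip: sum_divide_distrib)
qed

text \<open>The sums over \<open>u\<close> and over the pairs are interchanged, after which each
  pair contributes its excess. The admissible pairs depend on \<open>u\<close>, so the interchange
  is one of restricted sums.\<close>

lemma sum_betweenness:
  assumes "connected_channels n s"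
  shows "(\<Sum>u<n. betweenness n s u) = real n * (real n - 1) * (real n - 2) - total_excess n s"
proof -
  define Q where "Q = Sigma {..<n} (\<lambda>i. {..<n} - {i})"
  define f where "f u = (\<lambda>(i, j). real (num_shortest_paths_through n s u i j) / real (num_shortest_paths n s i j))" for u
  have "(\<Sum>u<n. \<Sum>ij\<in>{ij\<in>Q. fst ij \<noteq> u \<and> snd ij \<noteq> u}. f u ij) =
      (\<Sum>ij\<in>Q. \<Sum>u\<in>{u\<in>{..<n}. fst ij \<noteq> u \<and> snd ij \<noteq> u}. f u ij)"
    by (rule sum.swap_restrict) (auto simp: Q_def)
  also have "\<dots> = (\<Sum>(i, j)\<in>Q. hop_dist n s i j - 1)"
  proof (intro sum.cong refl)
    fix ij assume "ij \<in> Q"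
    then obtain i j where "ij = (i, j)" "i < n" "j < n" "i \<noteq> j" by (auto simp: Q_def)
    then show "(\<Sum>u\<in>{u\<in>{..<n}. fst ij \<noteq> u \<and> snd ij \<noteq> u}. f u ij) =
        (case ij of (i, j) \<Rightarrow> hop_dist n s i j - 1)"
      using sum_through_fraction[OF assms, of i j] by (simp add: f_def)
  qed
  also have "\<dots> = total_excess n s"
    unfolding Q_def total_excess_def by (rule sum.Sigma[symmetric]) auto
  finally have *: "(\<Sum>u<n. \<Sum>ij\<in>{ij\<in>Q. fst ij \<noteq> u \<and> snd ij \<noteq> u}. f u ij) = total_excess n s" .
  \<comment> \<open>In a connected graph every pair has a shortest path, so the positivity condition
    excludes no pair.\<close>
  have "{(i, j) \<in> players n \<times> players n. i \<noteq> j \<and> i \<noteq> u \<and> j \<noteq> u \<and> num_shortest_paths n s i j > 0} =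
      {ij\<in>Q. fst ij \<noteq> u \<and> snd ij \<noteq> u}" for u
    using num_shortest_paths_pos[OF assms] by (auto simp: Q_def players_def)
  then have "betweenness n s u = (real n - 1) * (real n - 2) - (\<Sum>ij\<in>{ij\<in>Q. fst ij \<noteq> u \<and> snd ij \<noteq> u}. f u ij)" for u
    unfolding betweenness_def f_def by presburger
  then show ?thesis by (simp add: sum_subtractf *)
qed

lemma closeness_eq:
  assumes "connected_channels n s" "u < n"
  shows "closeness n s u = ereal (\<Sum>v\<in>{..<n} - {u}. hop_dist n s u v - 1)"
proof -
  have "closeness n s u = (\<Sum>v\<in>{..<n} - {u}. ereal (hop_dist n s u v - 1))"
    unfolding closeness_def players_def
    using assms by (intro sum.cong) (auto simp: graph_dist_eq_hop_dist one_ereal_def)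
  then show ?thesis by simp
qed

lemma social_cost_connected:
  assumes "connected_channels n s"
  shows "social_cost n b c s = ereal ((\<Sum>u<n. real (card (s u))) +
    b * (real n * (real n - 1) * (real n - 2) - total_excess n s) + c * total_excess n s)"
proof -
  have "social_cost n b c s = (\<Sum>u<n. ereal (real (card (s u)) + b * betweenness n s u +
      c * (\<Sum>v\<in>{..<n} - {u}. hop_dist n s u v - 1)))"
    unfolding social_cost_def player_cost_def players_def
    using assms by (intro sum.cong) (auto simp: closeness_eq)
  also have "\<dots> = ereal (\<Sum>u<n. real (card (s u)) + b * betweenness n s u +
      c * (\<Sum>v\<in>{..<n} - {u}. hop_dist n s u v - 1))"
    by simp
  also have "\<dots> = ereal ((\<Sum>u<n. real (card (s u))) + b * (\<Sum>u<n. betweenness n s u) + c * total_excess n s)"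
    unfolding total_excess_def by (simp only: sum.distrib sum_distrib_left)
  finally show ?thesis using sum_betweenness[OF assms] by simp
qed

section \<open>The minimal social cost\<close>

text \<open>The path 0, 1, ..., n-1, each edge paid for by its smaller end. The restricted
  abstraction makes it a member of the extensional function space.\<close>

definition path_channels :: "nat \<Rightarrow> nat \<Rightarrow> nat set" where
  "path_channels n = (\<lambda>u\<in>players n. if Suc u < n then {Suc u} else {})"

lemma adjacent_path_channels:
  "adjacent n (path_channels n) u v \<longleftrightarrow> u < n \<and> v < n \<and> (v = Suc u \<or> u = Suc v)"
  by (auto simp: adjacent_def path_channels_def players_def)

lemma path_channels_in_strategy_combinations: "path_channels n \<in> strategy_combinations n"
  by (auto simp: path_channels_def strategy_combinations_def strategies_def players_def)

lemma connected_path_channels: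
  assumes "n > 0"
  shows "connected_channels n (path_channels n)"
proof -
  let ?awalk = "pre_digraph.awalk (channel_graph n (path_channels n))"
  \<comment> \<open>Walks in both directions between 0 and every vertex; any two vertices are then
    joined through 0.\<close>
  have "(\<exists>p. ?awalk 0 p k) \<and> (\<exists>p. ?awalk k p 0)" if "k < n" for k
    using that
  proof (induction k)
    case 0
    then have "?awalk 0 [] 0" by (simp add: awalk_channel_graph_iff)
    then show ?case by blast
  next
    case (Suc k)
    then obtain p q where "?awalk 0 p k" "?awalk k q 0" by auto
    moreover have "?awalk k [(k, Suc k)] (Suc k)" "?awalk (Suc k) [(Suc k, k)] k"
      using Suc.prems by (auto intro!: awalk_adjacent simp: adjacent_path_channels)
    ultimately show ?case using awalk_append by blast
  qed
  then show ?thesis using assms awalk_append unfolding connected_channel_graph_iff by meson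
qed

text \<open>Every arc changes the label by one, so a walk cannot be shorter than the difference of
  its end labels.\<close>

lemma hop_dist_path_channels_ge:
  assumes "u < n" "v < n"
  shows "\<bar>real u - real v\<bar> \<le> hop_dist n (path_channels n) u v"
proof -
  have len: "pcas i p j \<Longrightarrow> \<forall>(x, y)\<in>set p. \<bar>real x - real y\<bar> \<le> 1 \<Longrightarrow> \<bar>real i - real j\<bar> \<le> real (length p)"
    for i j p
    by (induction i p j rule: pcas.induct) force+
  obtain p where p: "p \<in> shortest_paths n (path_channels n) u v"
    using shortest_path_exists[OF connected_path_channels assms] assms by auto
  then have "\<bar>real u - real v\<bar> \<le> real (length p)"
    using shortest_path_awalk[OF p]
    by (intro len) (auto simp: awalk_channel_graph_iff adjacent_path_channels)
  then show ?thesis using shortest_path_length[OF p] by simp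
qed

lemma sum_abs_diff:
  "(\<Sum>u<n. \<Sum>v<n. \<bar>real u - real v\<bar>) = (real n - 1) * real n * (real n + 1) / 3"
proof (induction n)
  case (Suc n)
  \<comment> \<open>The range \<open>m\<close> is kept apart from \<open>n\<close>, so that the
    induction on \<open>m\<close> leaves the summand fixed.\<close>
  have gauss: "(\<Sum>v<m. real n - real v) = real m * real n - real m * (real m - 1) / 2" for m
    by (induction m) (auto simp: field_simps)
  have "(\<Sum>v<n. \<bar>real n - real v\<bar>) = real n * (real n + 1) / 2"
    using gauss[of n] by (simp add: field_simps)
  moreover have "(\<Sum>v<n. \<bar>real v - real n\<bar>) = (\<Sum>v<n. \<bar>real n - real v\<bar>)"
    by (simp add: abs_minus_commute)
  moreover have "(\<Sum>u<Suc n. \<Sum>v<Suc n. \<bar>real u - real v\<bar>) =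
      (\<Sum>u<n. \<Sum>v<n. \<bar>real u - real v\<bar>) + (\<Sum>v<n. \<bar>real v - real n\<bar>) + (\<Sum>v<n. \<bar>real n - real v\<bar>)"
    by (simp only: sum.lessThan_Suc sum.distrib diff_self abs_zero add_0_right)
  ultimately have "(\<Sum>u<Suc n. \<Sum>v<Suc n. \<bar>real u - real v\<bar>) =
      (real n - 1) * real n * (real n + 1) / 3 + real n * (real n + 1)"
    by (simp add: Suc)
  also have "\<dots> = (real (Suc n) - 1) * real (Suc n) * (real (Suc n) + 1) / 3"
    by (simp add: field_simps)
  finally show ?case .
qed simp

text \<open>No exact distance is computed: the label differences bound the excess from below, and
  the general bound for connected graphs meets them from above.\<close>

lemma total_excess_path_channels:
  assumes "n > 0"
  shows "total_excess n (path_channels n) = real n * (real n - 1) * (real n - 2) / 3"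
proof (rule antisym)
  have "(\<Sum>u<n. \<Sum>v<n. \<bar>real u - real v\<bar>) \<le> (\<Sum>u<n. \<Sum>v<n. hop_dist n (path_channels n) u v)"
    by (intro sum_mono hop_dist_path_channels_ge) auto
  then show "real n * (real n - 1) * (real n - 2) / 3 \<le> total_excess n (path_channels n)"
    unfolding sum_abs_diff total_excess_eq[OF connected_path_channels[OF assms]]
    by (simp add: field_simps)
qed (rule total_excess_le[OF connected_path_channels[OF assms]])

lemma sum_card_path_channels:
  assumes "n > 0"
  shows "(\<Sum>u<n. real (card (path_channels n u))) = real n - 1"
proof -
  obtain m where m: "n = Suc m" using assms gr0_implies_Suc by blast
  have "(\<Sum>u<n. real (card (path_channels n u))) = (\<Sum>u<m. real (card (path_channels n u)))"
    by (simp add: m path_channels_def players_def)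
  also have "\<dots> = (\<Sum>u<m. 1)"
    by (intro sum.cong refl) (simp add: m path_channels_def players_def)
  finally show ?thesis by (simp add: m)
qed

text \<open>One infinite distance makes a closeness term infinite, and \<open>c > 0\<close> carries
  it into the total. The minimum ranges over disconnected combinations too; this lemma disposes of
  them.\<close>

lemma social_cost_disconnected:
  assumes "n > 0" "\<not> connected_channels n s" "c > 0"
  shows "social_cost n b c s = \<infinity>"
proof -
  obtain u v where uv: "u < n" "v < n" "\<And>p. \<not> pre_digraph.awalk (channel_graph n s) u p v"
    using assms(1,2) by (auto simp: connected_channel_graph_iff)
  then have "graph_dist n s u v = \<infinity>" using le_graph_distI[of n s u v \<infinity>] by simp
  moreover have "u \<noteq> v" using uv(1) uv(3)[of "[]"] by (auto simp: awalk_channel_graph_iff)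
  ultimately have "closeness n s u = \<infinity>"
    unfolding closeness_def players_def using uv(2) by (auto simp: sum_Pinfty intro!: bexI[of _ v])
  then have "player_cost n b c s u = \<infinity>" using assms(3) by (simp add: player_cost_def)
  then show ?thesis unfolding social_cost_def players_def using uv(1) by (auto simp: sum_Pinfty)
qed

text \<open>The path has both the fewest purchases and the largest excess, so the two parts of the
  cost are bounded separately. The factor \<open>real n - 1\<close> is split off because the
  equilibrium cost has it too.\<close>

lemma Min_social_cost:
  assumes "n \<ge> 2" "0 < c" "c \<le> b"
  shows "Min (social_cost n b c ` strategy_combinations n) =
    ereal ((real n - 1) * (1 + (2/3 * b + 1/3 * c) * real n * (real n - 2)))"
    (is "_ = ereal ?M")
proof (rule Min_eqI)
  show "finite (social_cost n b c ` strategy_combinations n)"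
    unfolding strategy_combinations_def strategies_def players_def
    by (intro finite_imageI finite_PiE) auto
next
  have "social_cost n b c (path_channels n) = ereal ?M"
    using assms(1)
    by (simp add: social_cost_connected connected_path_channels total_excess_path_channels
        sum_card_path_channels field_simps)
  then show "ereal ?M \<in> social_cost n b c ` strategy_combinations n"
    using path_channels_in_strategy_combinations by (metis imageI)
next
  fix y assume "y \<in> social_cost n b c ` strategy_combinations n"
  then obtain s where s: "s \<in> strategy_combinations n" "y = social_cost n b c s" by blast
  show "ereal ?M \<le> y"
  proof (cases "connected_channels n s")
    case False
    then show ?thesis using s assms by (simp add: social_cost_disconnected)
  next
    case True
    let ?X = "real n * (real n - 1) * (real n - 2)"
    have "real n - 1 \<le> (\<Sum>u<n. real (card (s u)))"
      using s by (intro sum_card_strategies_ge[OF True])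
        (auto simp: strategy_combinations_def strategies_def players_def)
    moreover have "(b - c) * total_excess n s \<le> (b - c) * (?X / 3)"
      using assms(3) total_excess_le[OF True] by (intro mult_left_mono) auto
    \<comment> \<open>Collecting the excess gives it the coefficient \<open>- (b - c)\<close>, which
      is not positive, so an upper bound on the excess bounds the cost from below.\<close>
    moreover have "b * (?X - total_excess n s) + c * total_excess n s = b * ?X - (b - c) * total_excess n s"
      by (simp add: algebra_simps)
    ultimately have "real n - 1 + b * ?X - (b - c) * (?X / 3) \<le>
        (\<Sum>u<n. real (card (s u))) + b * (?X - total_excess n s) + c * total_excess n s"
      by linarith
    moreover have "?M = real n - 1 + b * ?X - (b - c) * (?X / 3)"
      by (simp add: field_simps)
    ultimately show ?thesis using s social_cost_connected[OF True] by simp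
  qed
qed

section \<open>Nash equilibria\<close>

lemma player_cost_connected:
  assumes "connected_channels n s" "u < n"
  shows "player_cost n b c s u = ereal (real (card (s u)) + b * betweenness n s u +
    c * (\<Sum>v\<in>{..<n} - {u}. hop_dist n s u v - 1))"
  using assms by (simp add: player_cost_def closeness_eq)

section \<open>Betweenness of a player under changes of the channels\<close>

lemma pcas_arc_in_pawalk_verts:
  "pcas u p v \<Longrightarrow> (x, y) \<in> set p \<Longrightarrow> x \<in> set (pawalk_verts u p) \<and> y \<in> set (pawalk_verts u p)"
  by (induction u p v rule: pcas.induct) (auto dest: pcas_ends_in_pawalk_verts)

lemma num_shortest_paths_split:
  "num_shortest_paths n s i j = num_shortest_paths_through n s u i j +
    card {p \<in> shortest_paths n s i j. u \<notin> set (pawalk_verts i p)}"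
proof -
  have "shortest_paths n s i j = {p \<in> shortest_paths n s i j. u \<in> set (pawalk_verts i p)} \<union>
      {p \<in> shortest_paths n s i j. u \<notin> set (pawalk_verts i p)}"
    by blast
  then show ?thesis
    unfolding num_shortest_paths_def num_shortest_paths_through_def awalk_verts_channel_graph
    using finite_shortest_paths[of n s i j]
    by (metis (no_types, lifting) card_Un_disjoint disjoint_iff finite_Un mem_Collect_eq)
qed

text \<open>New channels at \<open>u\<close> leave the paths avoiding \<open>u\<close> unchanged, so either the distance drops and
  every shortest path passes through \<open>u\<close>, or only paths through \<open>u\<close> are added.\<close>
lemma betweenness_antimono:
  assumes conn: "connected_channels n s"
    and sub: "\<And>x y. adjacent n s x y \<Longrightarrow> adjacent n t x y"
    and new: "\<And>x y. adjacent n t x y \<Longrightarrow> x \<noteq> u \<Longrightarrow> y \<noteq> u \<Longrightarrow> adjacent n s x y"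
  shows "connected_channels n t"
    and "\<And>i j. i < n \<Longrightarrow> j < n \<Longrightarrow> hop_dist n t i j \<le> hop_dist n s i j"
    and "betweenness n t u \<le> betweenness n s u"
proof -
  have walk: "pre_digraph.awalk (channel_graph n s) i p j \<Longrightarrow> pre_digraph.awalk (channel_graph n t) i p j"
    for i p j using sub by (auto simp: awalk_channel_graph_iff)
  have walk': "pre_digraph.awalk (channel_graph n s) i p j"
    if "pre_digraph.awalk (channel_graph n t) i p j" "u \<notin> set (pawalk_verts i p)" for i p j
    using that new pcas_arc_in_pawalk_verts[of i p j] by (fastforce simp: awalk_channel_graph_iff)
  show conn': "connected_channels n t"
    using conn walk unfolding connected_channel_graph_iff by meson
  show hop: "hop_dist n t i j \<le> hop_dist n s i j" if ij: "i < n" "j < n" for i j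
  proof -
    obtain p where p: "p \<in> shortest_paths n s i j" using shortest_path_exists[OF conn ij] .
    show ?thesis
      using hop_dist_le_length[OF conn' ij(2) walk[OF shortest_path_awalk[OF p]]]
        shortest_path_length[OF p] by simp
  qed
  have fraction: "real (num_shortest_paths_through n s u i j) / real (num_shortest_paths n s i j) \<le>
      real (num_shortest_paths_through n t u i j) / real (num_shortest_paths n t i j)"
    if ij: "i < n" "j < n" for i j
  proof -
    let ?avoid = "\<lambda>s. {p \<in> shortest_paths n s i j. u \<notin> set (pawalk_verts i p)}"
    let ?T = "\<lambda>s. real (num_shortest_paths_through n s u i j)" and ?N = "\<lambda>s. real (card (?avoid s))"
    have split: "real (num_shortest_paths n r i j) = ?T r + ?N r" for r
      using num_shortest_paths_split[of n r i j u] by simp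
    have pos: "0 < ?T s + ?N s" "0 < ?T t + ?N t"
      using num_shortest_paths_pos[OF conn ij] num_shortest_paths_pos[OF conn' ij]
      by (simp_all flip: split)
    \<comment> \<open>With both counts split as \<open>?T + ?N\<close>, this is the comparison of
      the two fractions after clearing denominators and cancelling the common product.\<close>
    have "?T s * ?N t \<le> ?T t * ?N s"
    proof (cases "?avoid t = {}")
      case False
      then obtain p where p: "p \<in> shortest_paths n t i j" "u \<notin> set (pawalk_verts i p)" by blast
      have "hop_dist n s i j \<le> hop_dist n t i j"
        using hop_dist_le_length[OF conn ij(2) walk'[OF shortest_path_awalk[OF p(1)] p(2)]]
          shortest_path_length[OF p(1)] by simp
      then have "hop_dist n s i j = hop_dist n t i j" using hop[OF ij] by simp
      then have dist: "graph_dist n s i j = graph_dist n t i j"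
        using graph_dist_eq_hop_dist conn conn' ij by simp
      have "?avoid t \<subseteq> ?avoid s"
        using walk' dist by (auto simp: shortest_paths_def apath_channel_graph_iff)
      then have N: "card (?avoid t) \<le> card (?avoid s)"
        using finite_shortest_paths[of n s i j] by (intro card_mono) auto
      have "shortest_paths n s i j \<subseteq> shortest_paths n t i j"
        using walk dist by (auto simp: shortest_paths_def apath_channel_graph_iff)
      then have "num_shortest_paths_through n s u i j \<le> num_shortest_paths_through n t u i j"
        unfolding num_shortest_paths_through_def awalk_verts_channel_graph
        using finite_shortest_paths[of n t i j] by (intro card_mono) auto
      then show ?thesis using N by (intro mult_mono) auto
    next
      case True
      then have "?N t = 0" by (simp only: card.empty of_nat_0)
      then show ?thesis by simp
    qed
    then show ?thesis unfolding split using pos by (simp add: field_simps)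
  qed
  have "{(i, j) \<in> players n \<times> players n. i \<noteq> j \<and> i \<noteq> u \<and> j \<noteq> u \<and> num_shortest_paths n r i j > 0} =
      {(i, j) \<in> {..<n} \<times> {..<n}. i \<noteq> j \<and> i \<noteq> u \<and> j \<noteq> u}" if "connected_channels n r" for r
    using num_shortest_paths_pos[OF that] by (auto simp: players_def)
  note sets = this[OF conn] this[OF conn']
  show "betweenness n t u \<le> betweenness n s u"
    unfolding betweenness_def sets using fraction by (auto intro!: sum_mono)
qed

text \<open>The only shortest path between adjacent vertices is the edge itself, which misses
  \<open>u\<close>. The channels at \<open>u\<close> are left arbitrary so that the lemma also
  covers deviations of \<open>u\<close>, even those that isolate her.\<close>

lemma betweenness_complete:
  assumes "\<And>x y. x < n \<Longrightarrow> y < n \<Longrightarrow> x \<noteq> y \<Longrightarrow> x \<noteq> u \<Longrightarrow> y \<noteq> u \<Longrightarrow> adjacent n s x y"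
  shows "betweenness n s u = (real n - 1) * (real n - 2)"
proof -
  have "num_shortest_paths_through n s u i j = 0"
    if ij: "i < n" "j < n" "i \<noteq> j" "i \<noteq> u" "j \<noteq> u" for i j
  proof -
    have "u \<notin> set (pawalk_verts i p)" if p: "p \<in> shortest_paths n s i j" for p
    proof -
      have "real (length p) = 1"
        using shortest_path_length[OF p] assms[OF ij] by (simp add: hop_dist_adjacent)
      then have "p = [(i, j)]"
        using shortest_path_awalk[OF p] by (auto simp: awalk_channel_graph_iff length_Suc_conv)
      then show ?thesis using ij by simp
    qed
    then show ?thesis by (auto simp: num_shortest_paths_through_def card_eq_0_iff)
  qed
  then show ?thesis unfolding betweenness_def by (auto simp: players_def intro!: sum.neutral)
qed

text \<open>Inequality of truth values is exclusive or: the purchases form a tournament, that is, a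
  complete graph with one payer for each edge.\<close>

definition bought_once :: "nat \<Rightarrow> (nat \<Rightarrow> nat set) \<Rightarrow> bool" where
  "bought_once n s \<longleftrightarrow> (\<forall>u<n. \<forall>v<n. u \<noteq> v \<longrightarrow> (v \<in> s u) \<noteq> (u \<in> s v))"

lemma nash_equilibrium_adjacent:
  assumes s: "s \<in> nash_equilibria n b c" and "0 \<le> b" "1 < c"
    and uv: "u < n" "v < n" "u \<noteq> v"
  shows "adjacent n s u v"
proof (rule ccontr)
  assume nadj: "\<not> adjacent n s u v"
  have conn: "connected_channels n s" and comb: "s \<in> strategy_combinations n"
    using s by (auto simp: nash_equilibria_def)
  have su: "s u \<subseteq> {..<n} - {u}" and "v \<notin> s u"
    using comb uv nadj by (auto simp: strategy_combinations_def strategies_def players_def adjacent_def)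
  let ?t = "s(u := insert v (s u))"
  have adj: "adjacent n ?t x y \<longleftrightarrow> adjacent n s x y \<or> (x, y) \<in> {(u, v), (v, u)}" for x y
    using uv by (auto simp: adjacent_def)
  note mono = betweenness_antimono[OF conn, of ?t u, unfolded adj, simplified]
  have conn': "connected_channels n ?t" using mono(1) by blast
  have hop: "hop_dist n ?t u w \<le> hop_dist n s u w" if "w < n" for w
    using mono(2)[of u w] uv that by blast
  have "betweenness n ?t u \<le> betweenness n s u" using mono(3) by blast
  then have btw: "b * betweenness n ?t u \<le> b * betweenness n s u"
    using assms(2) by (rule mult_left_mono)
  have "hop_dist n ?t u v = 1" using adj by (intro hop_dist_adjacent) simp
  moreover have "2 \<le> hop_dist n s u v"
    using graph_dist_ge_2[OF uv(3) nadj] graph_dist_eq_hop_dist[OF conn uv(1,2)] by simp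
  \<comment> \<open>The summand of \<open>v\<close> is split off: it drops by at least 1, while no
    other summand grows.\<close>
  moreover have "(\<Sum>w\<in>{..<n} - {u} - {v}. hop_dist n ?t u w - 1) \<le> (\<Sum>w\<in>{..<n} - {u} - {v}. hop_dist n s u w - 1)"
    using hop by (intro sum_mono) auto
  ultimately have "(\<Sum>w\<in>{..<n} - {u}. hop_dist n ?t u w - 1) + 1 \<le> (\<Sum>w\<in>{..<n} - {u}. hop_dist n s u w - 1)"
    using uv by (simp add: sum.remove[of _ v])
  then have "c * ((\<Sum>w\<in>{..<n} - {u}. hop_dist n ?t u w - 1) + 1) \<le> c * (\<Sum>w\<in>{..<n} - {u}. hop_dist n s u w - 1)"
    using assms(3) by (intro mult_left_mono) auto
  moreover have "finite (s u)" using su finite_subset by blast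
  then have "card (?t u) = Suc (card (s u))" using \<open>v \<notin> s u\<close> by simp
  ultimately have "player_cost n b c ?t u < player_cost n b c s u"
    using btw assms(3) uv(1) unfolding player_cost_connected[OF conn uv(1)] player_cost_connected[OF conn' uv(1)]
    by (simp add: algebra_simps)
  moreover have "insert v (s u) \<in> strategies n u" "u \<in> players n"
    using su uv by (auto simp: strategies_def players_def)
  ultimately show False using s unfolding nash_equilibria_def by blast
qed

lemma betweenness_closeness_cong:
  assumes "channel_graph n s = channel_graph n t"
  shows "betweenness n s u = betweenness n t u" "closeness n s u = closeness n t u"
  unfolding betweenness_def closeness_def num_shortest_paths_def num_shortest_paths_through_def
    shortest_paths_def graph_dist_def assms
  by (rule refl)+

text \<open>Dropping a channel that both ends pay for leaves the graph unchanged and saves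
  1.\<close>

lemma nash_equilibrium_bought_once:
  assumes s: "s \<in> nash_equilibria n b c" and "0 \<le> b" "1 < c"
  shows "bought_once n s"
proof -
  have conn: "connected_channels n s" and comb: "s \<in> strategy_combinations n"
    using s by (auto simp: nash_equilibria_def)
  have False if uv: "u < n" "v < n" "u \<noteq> v" and both: "v \<in> s u" "u \<in> s v" for u v
  proof -
    let ?t = "s(u := s u - {v})"
    have "channel_graph n ?t = channel_graph n s"
      using uv both by (intro channel_graph_cong) (auto simp: adjacent_def)
    note cong = betweenness_closeness_cong[OF this]
    have su: "s u \<subseteq> {..<n} - {u}"
      using comb uv by (auto simp: strategy_combinations_def strategies_def players_def)
    then have "finite (s u)" using finite_subset by blast
    then have "card (s u) = Suc (card (?t u))" using both by (simp only: fun_upd_same card_Suc_Diff1)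
    \<comment> \<open>Connectedness makes the closeness finite; with an infinite closeness the
      strict inequality would be lost.\<close>
    then have "player_cost n b c ?t u < player_cost n b c s u"
      unfolding player_cost_def cong closeness_eq[OF conn uv(1)] by simp
    moreover have "s u - {v} \<in> strategies n u" "u \<in> players n"
      using su uv by (auto simp: strategies_def players_def)
    ultimately show False using s unfolding nash_equilibria_def by blast
  qed
  then show ?thesis
    using nash_equilibrium_adjacent[OF assms] unfolding bought_once_def adjacent_def by blast
qed

lemma bought_once_adjacent:
  "bought_once n s \<Longrightarrow> u < n \<Longrightarrow> v < n \<Longrightarrow> u \<noteq> v \<Longrightarrow> adjacent n s u v"
  unfolding bought_once_def adjacent_def by blast

lemma bought_once_connected:
  assumes "bought_once n s" "n > 0"
  shows "connected_channels n s"
proof -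
  have "\<exists>p. pre_digraph.awalk (channel_graph n s) u p v" if uv: "u < n" "v < n" for u v
  proof (cases "u = v")
    case True
    then show ?thesis using uv by (intro exI[of _ "[]"]) (simp add: awalk_channel_graph_iff)
  next
    case False
    then show ?thesis using bought_once_adjacent[OF assms(1) uv] awalk_adjacent by blast
  qed
  then show ?thesis using assms(2) by (simp add: connected_channel_graph_iff)
qed

text \<open>The other players form a complete graph, so no deviation of \<open>u\<close> changes her
  betweenness. Each channel in \<open>s u - t\<close> is given up by its only payer, which costs at
  least \<open>c\<close> in closeness and saves one purchase, and \<open>1 \<le> c\<close>.\<close>

lemma bought_once_nash_equilibrium:
  assumes "bought_once n s" "s \<in> strategy_combinations n" "n > 0" "1 \<le> c"
  shows "s \<in> nash_equilibria n b c"
proof -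
  have conn: "connected_channels n s" using assms(1,3) by (rule bought_once_connected)
  have "player_cost n b c s u \<le> player_cost n b c (s(u := t)) u"
    if u: "u < n" and t: "t \<subseteq> {..<n} - {u}" for u t
  proof -
    let ?s = "s(u := t)"
    have btw: "betweenness n s u = (real n - 1) * (real n - 2)"
      "betweenness n ?s u = (real n - 1) * (real n - 2)"
      using bought_once_adjacent[OF assms(1)]
      by (intro betweenness_complete; fastforce simp: adjacent_def)+
    have su: "s u \<subseteq> {..<n} - {u}"
      using assms(2) u by (auto simp: strategy_combinations_def strategies_def players_def)
    \<comment> \<open>This stays in the extended reals because the deviation may disconnect
      \<open>u\<close>.\<close>
    have "(\<Sum>v\<in>{..<n} - {u}. if v \<in> s u - t then 1 else 0) \<le> closeness n ?s u"
      unfolding closeness_def players_def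
    proof (rule sum_mono)
      fix v assume v: "v \<in> {..<n} - {u}"
      show "(if v \<in> s u - t then 1 else 0) \<le> graph_dist n ?s u v - 1"
      proof (cases "v \<in> s u - t")
        case True
        then have "u \<notin> s v" using assms(1) u v unfolding bought_once_def by blast
        then have "\<not> adjacent n ?s u v" using True v by (auto simp: adjacent_def)
        then have "2 \<le> graph_dist n ?s u v" using v by (intro graph_dist_ge_2) auto
        then show ?thesis using True by (cases "graph_dist n ?s u v") (auto simp: one_ereal_def)
      next
        case False
        have "1 \<le> graph_dist n ?s u v" using v by (intro graph_dist_ge_1) auto
        then show ?thesis using False by (cases "graph_dist n ?s u v") (auto simp: one_ereal_def zero_ereal_def)
      qed
    qed
    moreover have "(\<Sum>v\<in>{..<n} - {u}. if v \<in> s u - t then 1 else 0 :: ereal) = ereal (real (card (s u - t)))"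
    proof -
      have "(\<Sum>v\<in>{..<n} - {u}. if v \<in> s u - t then 1 else 0 :: ereal) =
          (\<Sum>v\<in>{..<n} - {u}. ereal (if v \<in> s u - t then 1 else 0))"
        by (intro sum.cong) auto
      also have "\<dots> = ereal (real (card (({..<n} - {u}) \<inter> (s u - t))))"
        by (simp add: sum.If_cases set_diff_eq)
      also have "({..<n} - {u}) \<inter> (s u - t) = s u - t" using su by auto
      finally show ?thesis .
    qed
    ultimately have close: "ereal c * ereal (real (card (s u - t))) \<le> ereal c * closeness n ?s u"
      using assms(4) by (intro ereal_mult_left_mono) auto
    have "card (s u) \<le> card t + card (s u - t)"
    proof -
      have "card (s u) \<le> card (t \<union> (s u - t))"
        using su t by (intro card_mono) (auto intro: finite_subset)
      also have "\<dots> \<le> card t + card (s u - t)" by (rule card_Un_le)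
      finally show ?thesis .
    qed
    then have "real (card (s u)) \<le> real (card t) + 1 * real (card (s u - t))" by simp
    then have "real (card (s u)) \<le> real (card t) + c * real (card (s u - t))"
      using assms(4) mult_right_mono[of 1 c "real (card (s u - t))"] by simp
    moreover have "(\<Sum>v\<in>{..<n} - {u}. hop_dist n s u v - 1) = 0"
      using bought_once_adjacent[OF assms(1) u] by (intro sum.neutral) (auto simp: hop_dist_adjacent)
    then have "player_cost n b c s u = ereal (real (card (s u)) + b * ((real n - 1) * (real n - 2)))"
      by (simp add: player_cost_connected[OF conn u] btw)
    ultimately have "player_cost n b c s u \<le>
        ereal (real (card t) + b * ((real n - 1) * (real n - 2))) + ereal c * ereal (real (card (s u - t)))"
      by simp
    also have "\<dots> \<le> player_cost n b c ?s u"
      unfolding player_cost_def btw fun_upd_same by (rule add_left_mono[OF close])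
    finally show ?thesis .
  qed
  then show ?thesis
    using assms(2) conn
    by (simp add: nash_equilibria_def strategies_def players_def not_less Ball_def)
qed

lemma nash_equilibria_eq:
  assumes "n > 0" "0 \<le> b" "1 < c"
  shows "nash_equilibria n b c = {s \<in> strategy_combinations n. bought_once n s}"
proof (intro Set.set_eqI iffI)
  fix s assume "s \<in> nash_equilibria n b c"
  then show "s \<in> {s \<in> strategy_combinations n. bought_once n s}"
    using nash_equilibrium_bought_once[OF _ assms(2,3)] unfolding nash_equilibria_def by blast
qed (use assms bought_once_nash_equilibrium in simp)

text \<open>The purchases \<open>R\<close> and their converse partition the ordered pairs of
  distinct players, so twice the number of purchases is n(n-1).\<close>

lemma sum_card_bought_once:
  assumes "bought_once n s" "s \<in> strategy_combinations n"
  shows "(\<Sum>u<n. real (card (s u))) = real n * (real n - 1) / 2"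
proof -
  have s: "s u \<subseteq> {..<n} - {u}" if "u < n" for u
    using assms(2) that by (auto simp: strategy_combinations_def strategies_def players_def)
  then have fin: "finite (s u)" if "u < n" for u using that finite_subset by blast
  define R where "R = Sigma {..<n} s"
  have "finite R" unfolding R_def using fin by auto
  have "R \<union> R\<inverse> = Sigma {..<n} (\<lambda>u. {..<n} - {u})"
    using s assms(1) unfolding R_def bought_once_def by blast
  moreover have "R \<inter> R\<inverse> = {}" using s assms(1) unfolding R_def bought_once_def by blast
  ultimately have "card R + card (R\<inverse>) = card (Sigma {..<n} (\<lambda>u. {..<n} - {u}))"
    using \<open>finite R\<close> by (metis card_Un_disjoint finite_converse)
  also have "\<dots> = n * (n - 1)" by simp
  finally have "card R * 2 = n * (n - 1)" by simp
  then have "real (card R) * 2 = real (n * (n - 1))" by (metis of_nat_mult of_nat_numeral)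
  also have "\<dots> = real n * (real n - 1)" by (cases n) (auto simp: algebra_simps)
  finally show ?thesis using fin by (simp add: R_def)
qed

lemma social_cost_bought_once:
  assumes "bought_once n s" "s \<in> strategy_combinations n" "n > 0"
  shows "social_cost n b c s = ereal ((real n - 1) * ((1/2 + (real n - 2) * b) * real n))"
proof -
  have "total_excess n s = 0"
    unfolding total_excess_def using bought_once_adjacent[OF assms(1)]
    by (auto intro!: sum.neutral simp: hop_dist_adjacent)
  then show ?thesis
    using sum_card_bought_once[OF assms(1,2)] social_cost_connected[OF bought_once_connected[OF assms(1,3)]]
    by (simp add: field_simps)
qed

lemma Max_social_cost_nash:
  assumes "n > 0" "0 \<le> b" "1 < c"
  shows "Max (social_cost n b c ` nash_equilibria n b c) =
    ereal ((real n - 1) * ((1/2 + (real n - 2) * b) * real n))"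
proof -
  \<comment> \<open>A witness that equilibria exist: every player pays for the channels to all
    smaller ones. As all equilibria cost the same, the maximum is over a singleton.\<close>
  define s where "s = (\<lambda>u\<in>players n. {..<u})"
  have "s \<in> strategy_combinations n" "bought_once n s"
    by (auto simp: s_def strategy_combinations_def strategies_def players_def bought_once_def)
  then have "social_cost n b c ` nash_equilibria n b c =
      {ereal ((real n - 1) * ((1/2 + (real n - 2) * b) * real n))}"
    unfolding nash_equilibria_eq[OF assms] using social_cost_bought_once assms(1) by auto
  then show ?thesis by simp
qed

theorem corollary3:
  fixes n :: nat and b c :: real
  assumes "n \<ge> 2" and "1 < c" and "c < b"
  shows "price_of_anarchy n b c =
    ereal (((1/2 + (real n - 2) * b) * real n) /
           (1 + (2/3 * b + 1/3 * c) * real n * (real n - 2)))"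
proof -
  let ?D = "1 + (2/3 * b + 1/3 * c) * real n * (real n - 2)"
  have "0 \<le> (2/3 * b + 1/3 * c) * real n * (real n - 2)"
    using assms by (intro mult_nonneg_nonneg) auto
  \<comment> \<open>A nonzero denominator turns the extended quotient into a real one, in which the
    common factor \<open>real n - 1\<close> cancels.\<close>
  then have "?D \<noteq> 0" by linarith
  moreover have "real n - 1 \<noteq> 0" using assms(1) by simp
  moreover have "Max (social_cost n b c ` nash_equilibria n b c) =
      ereal ((real n - 1) * ((1/2 + (real n - 2) * b) * real n))"
    using assms by (intro Max_social_cost_nash) auto
  moreover have "Min (social_cost n b c ` strategy_combinations n) = ereal ((real n - 1) * ?D)"
    using assms by (intro Min_social_cost) auto
  ultimately show ?thesis by (simp add: price_of_anarchy_def)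
qed

end
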